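(* Let $G$ be a formula, let $\mathcal T$ be a $\mathbf{GBU}(G)$-tree and let $\tau$ be its root sequent. Then the height of $\mathcal T$ is $O(|\tau|^2)$, where $|\tau|$ is the number of logical symbols occurring in $\tau$.
   Context: Formulas are built from a countably infinite set of propositional variables and $\bot$ using $\land,\lor,\supset$. For a formula $G$, $\mathrm{Sl}(G)$ and $\mathrm{Sr}(G)$ are the smallest subsets of the subformulas of $G$ with: $G\in\mathrm{Sr}(G)$; $A\land B$ or $A\lor B$ in $\mathrm{Sl}(G)$ (resp. $\mathrm{Sr}(G)$) implies $A,B$ in $\mathrm{Sl}(G)$ (resp. $\mathrm{Sr}(G)$); $A\supset B\in\mathrm{Sl}(G)$ implies $B\in\mathrm{Sl}(G)$, $A\in\mathrm{Sr}(G)$; $A\supset B\in\mathrm{Sr}(G)$ implies $B\in\mathrm{Sr}(G)$, $A\in\mathrm{Sl}(G)$. $\mathrm{Cl}(\Gamma)$ is the smallest set containing $\Gamma$ such that if $X,Y\in\mathrm{Cl}(\Gamma)$ and $A$ is any formula then $X\land Y,A\lor X,X\lor A,A\supset X\in\mathrm{Cl}(\Gamma)$. Commas denote union. $\mathbf{GBU}(G)$: sequents regular $\Psi\Rightarrow_g A$ and irregular $\Psi\rightarrow_g A$ with $\Psi\subseteq\mathrm{Sl}(G)$, $A\in\mathrm{Sr}(G)$ (all sequents in rules satisfy this). Rules ($k\in\{1,2\}$): axioms $A,\Psi\Rightarrow_g A$, $\bot,\Psi\Rightarrow_g C$, $A,\Psi\rightarrow_g A$; $L\land$: $A,B,\Psi\Rightarrow_g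 C/A\land B,\Psi\Rightarrow_g C$; $R\land$: $\Psi\Rightarrow_g A$, $\Psi\Rightarrow_g B/\Psi\Rightarrow_g A\land B$ and likewise with $\rightarrow_g$ throughout; $L\lor$: $A,\Psi\Rightarrow_g C$, $B,\Psi\Rightarrow_g C/A\lor B,\Psi\Rightarrow_g C$; $R\lor_k$: $\Psi\rightarrow_g C_k/\Psi\Rightarrow_g C_1\lor C_2$ and $\Psi\rightarrow_g C_k/\Psi\rightarrow_g C_1\lor C_2$; $L\supset$: $A\supset B,\Psi\rightarrow_g A$, $B,\Psi\Rightarrow_g C/A\supset B,\Psi\Rightarrow_g C$; $\supset R_\in$: $\Psi\Rightarrow_g B/\Psi\Rightarrow_g A\supset B$ and $\Psi\rightarrow_g B/\Psi\rightarrow_g A\supset B$, if $A\in\mathrm{Cl}(\Psi)$; $\supset R_{\notin}$: $A,\Psi\Rightarrow_g B/\Psi\Rightarrow_g A\supset B$ and $A,\Psi\Rightarrow_g B/\Psi\rightarrow_g A\supset B$, if $A\notin\mathrm{Cl}(\Psi)$. A $\mathbf{GBU}(G)$-tree is a finite tree of $\mathbf{GBU}(G)$-sequents in which every internal node is the conclusion of a rule instance whose premises are its children (leaves need not be axioms); its height is the number of edges of a longest root-to-leaf path.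
   Formalization: In the left rules (L∧, L∨, L⊃) the set Ψ is required not to contain the principal formula; with commas as plain union, L∧ on p∧q, p, q ⇒ r has a premise equal to its conclusion, so heights would be unbounded. *)

theory Defs
  imports Main
begin

datatype form =
    Var nat
  | Bot  ("\<^bold>\<bottom>")
  | And form form  (infixr "\<^bold>\<and>" 65)
  | Or form form  (infixr "\<^bold>\<or>" 60)
  | Imp form form  (infixr "\<^bold>\<longrightarrow>" 55)

fun subformulas :: "form \<Rightarrow> form set" where
  "subformulas (Var p) = {Var p}"
| "subformulas \<^bold>\<bottom> = {\<^bold>\<bottom>}"
| "subformulas (A \<^bold>\<and> B) = insert (A \<^bold>\<and> B) (subformulas A \<union> subformulas B)"
| "subformulas (A \<^bold>\<or> B) = insert (A \<^bold>\<or> B) (subformulas A \<union> subformulas B)"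
| "subformulas (A \<^bold>\<longrightarrow> B) = insert (A \<^bold>\<longrightarrow> B) (subformulas A \<union> subformulas B)"

inductive_set Sl :: "form \<Rightarrow> form set" and Sr :: "form \<Rightarrow> form set" for G :: form where
  Sr_self: "G \<in> Sr G"
| Sl_andL: "A \<^bold>\<and> B \<in> Sl G \<Longrightarrow> A \<in> Sl G"
| Sl_andR: "A \<^bold>\<and> B \<in> Sl G \<Longrightarrow> B \<in> Sl G"
| Sl_orL: "A \<^bold>\<or> B \<in> Sl G \<Longrightarrow> A \<in> Sl G"
| Sl_orR: "A \<^bold>\<or> B \<in> Sl G \<Longrightarrow> B \<in> Sl G"
| Sr_andL: "A \<^bold>\<and> B \<in> Sr G \<Longrightarrow> A \<in> Sr G"
| Sr_andR: "A \<^bold>\<and> B \<in> Sr G \<Longrightarrow> B \<in> Sr G"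
| Sr_orL: "A \<^bold>\<or> B \<in> Sr G \<Longrightarrow> A \<in> Sr G"
| Sr_orR: "A \<^bold>\<or> B \<in> Sr G \<Longrightarrow> B \<in> Sr G"
| Sl_impR: "A \<^bold>\<longrightarrow> B \<in> Sl G \<Longrightarrow> B \<in> Sl G"
| Sr_impL: "A \<^bold>\<longrightarrow> B \<in> Sl G \<Longrightarrow> A \<in> Sr G"
| Sr_impR: "A \<^bold>\<longrightarrow> B \<in> Sr G \<Longrightarrow> B \<in> Sr G"
| Sl_impL: "A \<^bold>\<longrightarrow> B \<in> Sr G \<Longrightarrow> A \<in> Sl G"

lemma finite_subformulas: "finite (subformulas A)"
  by (induction A) auto

lemma subformulas_self: "A \<in> subformulas A"
  by (cases A) auto

lemma subformulas_trans: "A \<in> subformulas B \<Longrightarrow> subformulas A \<subseteq> subformulas B"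
  by (induction B) auto

lemma Sl_Sr_subformulas:
  "A \<in> Sl G \<Longrightarrow> A \<in> subformulas G" "B \<in> Sr G \<Longrightarrow> B \<in> subformulas G"
  by (induction rule: Sl_Sr.inducts)
    (use subformulas_self subformulas_trans in fastforce)+

lemma finite_Sl: "finite (Sl G)"
  by (rule finite_subset[OF _ finite_subformulas[of G]]) (auto dest: Sl_Sr_subformulas)

inductive_set Cl :: "form set \<Rightarrow> form set" for \<Gamma> :: "form set" where
  Cl_base: "X \<in> \<Gamma> \<Longrightarrow> X \<in> Cl \<Gamma>"
| Cl_and: "X \<in> Cl \<Gamma> \<Longrightarrow> Y \<in> Cl \<Gamma> \<Longrightarrow> X \<^bold>\<and> Y \<in> Cl \<Gamma>"
| Cl_or1: "X \<in> Cl \<Gamma> \<Longrightarrow> A \<^bold>\<or> X \<in> Cl \<Gamma>"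
| Cl_or2: "X \<in> Cl \<Gamma> \<Longrightarrow> X \<^bold>\<or> A \<in> Cl \<Gamma>"
| Cl_imp: "X \<in> Cl \<Gamma> \<Longrightarrow> A \<^bold>\<longrightarrow> X \<in> Cl \<Gamma>"

datatype sequent =
    Regular "form set" form  (infix "\<Rightarrow>\<^sub>g" 50)
  | Irregular "form set" form  (infix "\<rightarrow>\<^sub>g" 50)

fun GBU_sequent :: "form \<Rightarrow> sequent \<Rightarrow> bool" where
  "GBU_sequent G (\<Psi> \<Rightarrow>\<^sub>g A) \<longleftrightarrow> \<Psi> \<subseteq> Sl G \<and> A \<in> Sr G"
| "GBU_sequent G (\<Psi> \<rightarrow>\<^sub>g A) \<longleftrightarrow> \<Psi> \<subseteq> Sl G \<and> A \<in> Sr G"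

text \<open>
  Rule instances: list of premises and conclusion. In the left rules the comma in the conclusion
  separates the principal formula from the rest \<open>\<Psi>\<close> of the antecedent, so \<open>\<Psi>\<close> does not contain the
  principal formula. Without this proviso a left rule need not consume its principal formula:
  for \<open>\<Psi> = {A \<^bold>\<and> B, A, B}\<close> the premise of \<open>L_and\<close> would equal its conclusion and trees with a given
  root would have unbounded height. Elsewhere the comma is plain union.
\<close>

inductive GBU_rule :: "sequent list \<Rightarrow> sequent \<Rightarrow> bool" where
  Ax_reg: "GBU_rule [] (insert A \<Psi> \<Rightarrow>\<^sub>g A)"
| Ax_bot: "GBU_rule [] (insert \<^bold>\<bottom> \<Psi> \<Rightarrow>\<^sub>g C)"
| Ax_irr: "GBU_rule [] (insert A \<Psi> \<rightarrow>\<^sub>g A)"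
| L_and: "A \<^bold>\<and> B \<notin> \<Psi> \<Longrightarrow>
    GBU_rule [insert A (insert B \<Psi>) \<Rightarrow>\<^sub>g C] (insert (A \<^bold>\<and> B) \<Psi> \<Rightarrow>\<^sub>g C)"
| R_and_reg: "GBU_rule [\<Psi> \<Rightarrow>\<^sub>g A, \<Psi> \<Rightarrow>\<^sub>g B] (\<Psi> \<Rightarrow>\<^sub>g A \<^bold>\<and> B)"
| R_and_irr: "GBU_rule [\<Psi> \<rightarrow>\<^sub>g A, \<Psi> \<rightarrow>\<^sub>g B] (\<Psi> \<rightarrow>\<^sub>g A \<^bold>\<and> B)"
| L_or: "A \<^bold>\<or> B \<notin> \<Psi> \<Longrightarrow>
    GBU_rule [insert A \<Psi> \<Rightarrow>\<^sub>g C, insert B \<Psi> \<Rightarrow>\<^sub>g C] (insert (A \<^bold>\<or> B) \<Psi> \<Rightarrow>\<^sub>g C)"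
| R_or1_reg: "GBU_rule [\<Psi> \<rightarrow>\<^sub>g A] (\<Psi> \<Rightarrow>\<^sub>g A \<^bold>\<or> B)"
| R_or2_reg: "GBU_rule [\<Psi> \<rightarrow>\<^sub>g B] (\<Psi> \<Rightarrow>\<^sub>g A \<^bold>\<or> B)"
| R_or1_irr: "GBU_rule [\<Psi> \<rightarrow>\<^sub>g A] (\<Psi> \<rightarrow>\<^sub>g A \<^bold>\<or> B)"
| R_or2_irr: "GBU_rule [\<Psi> \<rightarrow>\<^sub>g B] (\<Psi> \<rightarrow>\<^sub>g A \<^bold>\<or> B)"
| L_imp: "A \<^bold>\<longrightarrow> B \<notin> \<Psi> \<Longrightarrow>
    GBU_rule [insert (A \<^bold>\<longrightarrow> B) \<Psi> \<rightarrow>\<^sub>g A, insert B \<Psi> \<Rightarrow>\<^sub>g C] (insert (A \<^bold>\<longrightarrow> B) \<Psi> \<Rightarrow>\<^sub>g C)"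
| R_imp_in_reg: "A \<in> Cl \<Psi> \<Longrightarrow> GBU_rule [\<Psi> \<Rightarrow>\<^sub>g B] (\<Psi> \<Rightarrow>\<^sub>g A \<^bold>\<longrightarrow> B)"
| R_imp_in_irr: "A \<in> Cl \<Psi> \<Longrightarrow> GBU_rule [\<Psi> \<rightarrow>\<^sub>g B] (\<Psi> \<rightarrow>\<^sub>g A \<^bold>\<longrightarrow> B)"
| R_imp_notin_reg: "A \<notin> Cl \<Psi> \<Longrightarrow> GBU_rule [insert A \<Psi> \<Rightarrow>\<^sub>g B] (\<Psi> \<Rightarrow>\<^sub>g A \<^bold>\<longrightarrow> B)"
| R_imp_notin_irr: "A \<notin> Cl \<Psi> \<Longrightarrow> GBU_rule [insert A \<Psi> \<Rightarrow>\<^sub>g B] (\<Psi> \<rightarrow>\<^sub>g A \<^bold>\<longrightarrow> B)"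

datatype tree = Node (root: sequent) (children: "tree list")

text \<open>
  A node without children is an arbitrary sequent over \<open>G\<close>, not necessarily an axiom.
  The requirement that all sequents in a rule instance be sequents over \<open>G\<close> is imposed here.
\<close>

inductive GBU_tree :: "form \<Rightarrow> tree \<Rightarrow> bool" for G :: form where
  Leaf: "GBU_sequent G \<sigma> \<Longrightarrow> GBU_tree G (Node \<sigma> [])"
| Step: "GBU_sequent G \<sigma> \<Longrightarrow> ts \<noteq> [] \<Longrightarrow> GBU_rule (map root ts) \<sigma> \<Longrightarrow>
    (\<And>t. t \<in> set ts \<Longrightarrow> GBU_tree G t) \<Longrightarrow> GBU_tree G (Node \<sigma> ts)"

fun height :: "tree \<Rightarrow> nat" where
  "height (Node \<sigma> ts) = (if ts = [] then 0 else Suc (Max (height ` set ts)))"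

text \<open>Logical symbols are \<open>\<^bold>\<bottom>\<close>, \<open>\<^bold>\<and>\<close>, \<open>\<^bold>\<or>\<close>, \<open>\<^bold>\<longrightarrow>\<close>; propositional variables are not counted.\<close>

fun symbols :: "form \<Rightarrow> nat" where
  "symbols (Var p) = 0"
| "symbols \<^bold>\<bottom> = 1"
| "symbols (A \<^bold>\<and> B) = symbols A + symbols B + 1"
| "symbols (A \<^bold>\<or> B) = symbols A + symbols B + 1"
| "symbols (A \<^bold>\<longrightarrow> B) = symbols A + symbols B + 1"

text \<open>For sequents over a formula \<open>G\<close> the antecedent is finite (\<open>finite_Sl\<close>), so the sum is genuine.\<close>

fun seq_size :: "sequent \<Rightarrow> nat" where
  "seq_size (\<Psi> \<Rightarrow>\<^sub>g A) = (\<Sum>F\<in>\<Psi>. symbols F) + symbols A"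
| "seq_size (\<Psi> \<rightarrow>\<^sub>g A) = (\<Sum>F\<in>\<Psi>. symbols F) + symbols A"

end

(*
  Along a branch the closure Cl of the antecedent never shrinks, and every use of the rule leading
  from an irregular conclusion to a regular premise puts a new antecedent of an implication into it.
  Such antecedents number at most |tau|, so a branch has at most |tau| of these passages. Every other
  rule lowers the size of the sequent, except the left premise of L_imp, which passes from regular
  to irregular and exchanges the succedent for a formula of size below |tau|. A weight of |tau| for
  each antecedent not yet in the closure, and a bonus of |tau| for regular sequents, combine to a
  potential that decreases strictly in every rule and is at most 3 |tau|^2 at the root.
*)
theory Submission
  imports Defs
begin

fun antecedent :: "sequent \<Rightarrow> form set" where
  "antecedent (\<Psi> \<Rightarrow>\<^sub>g A) = \<Psi>"
| "antecedent (\<Psi> \<rightarrow>\<^sub>g A) = \<Psi>"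

fun succedent :: "sequent \<Rightarrow> form" where
  "succedent (\<Psi> \<Rightarrow>\<^sub>g A) = A"
| "succedent (\<Psi> \<rightarrow>\<^sub>g A) = A"

abbreviation seq_forms :: "sequent \<Rightarrow> form set" where
  "seq_forms \<sigma> \<equiv> insert (succedent \<sigma>) (antecedent \<sigma>)"

definition imp_antecedents :: "form set \<Rightarrow> form set" where
  "imp_antecedents S = {A. \<exists>B. A \<^bold>\<longrightarrow> B \<in> S}"

definition subformula_closed :: "form set \<Rightarrow> bool" where
  "subformula_closed S \<longleftrightarrow> (\<forall>F\<in>S. subformulas F \<subseteq> S)"

text \<open>\<open>S\<close> and \<open>N\<close> stay fixed along the whole tree instead of being
  computed from each sequent, so the values at a conclusion and at its premises are
  comparable.\<close>

fun potential :: "form set \<Rightarrow> nat \<Rightarrow> sequent \<Rightarrow> nat" where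
  "potential S N (\<Psi> \<Rightarrow>\<^sub>g C) =
     N * card (imp_antecedents S - Cl \<Psi>) + (\<Sum>F\<in>\<Psi>. symbols F) + symbols C + N"
| "potential S N (\<Psi> \<rightarrow>\<^sub>g C) =
     N * card (imp_antecedents S - Cl \<Psi>) + (\<Sum>F\<in>\<Psi>. symbols F) + symbols C"

lemma Cl_least: "\<Gamma> \<subseteq> Cl \<Delta> \<Longrightarrow> Cl \<Gamma> \<subseteq> Cl \<Delta>"
proof
  fix X assume "X \<in> Cl \<Gamma>" and "\<Gamma> \<subseteq> Cl \<Delta>"
  then show "X \<in> Cl \<Delta>"
    by (induction rule: Cl.induct) (auto intro: Cl.intros)
qed

lemma imp_antecedents_UN: "imp_antecedents (\<Union>F\<in>X. h F) = (\<Union>F\<in>X. imp_antecedents (h F))"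
  by (auto simp: imp_antecedents_def)

text \<open>Only an implication adds an antecedent of its own, and its arrow is the symbol that pays
  for it.\<close>

lemma imp_antecedents_subformulas:
  "finite (imp_antecedents (subformulas F)) \<and> card (imp_antecedents (subformulas F)) \<le> symbols F"
proof (induction F)
  case (And A B)
  have "imp_antecedents (subformulas (A \<^bold>\<and> B))
      = imp_antecedents (subformulas A) \<union> imp_antecedents (subformulas B)"
    by (auto simp: imp_antecedents_def)
  moreover have "card \<dots> \<le>
      card (imp_antecedents (subformulas A)) + card (imp_antecedents (subformulas B))"
    by (rule card_Un_le)
  ultimately show ?case using And by simp
next
  case (Or A B)
  have "imp_antecedents (subformulas (A \<^bold>\<or> B))
      = imp_antecedents (subformulas A) \<union> imp_antecedents (subformulas B)"
    by (auto simp: imp_antecedents_def)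
  moreover have "card \<dots> \<le>
      card (imp_antecedents (subformulas A)) + card (imp_antecedents (subformulas B))"
    by (rule card_Un_le)
  ultimately show ?case using Or by simp
next
  case (Imp A B)
  have "imp_antecedents (subformulas (A \<^bold>\<longrightarrow> B))
      = insert A (imp_antecedents (subformulas A) \<union> imp_antecedents (subformulas B))"
    by (auto simp: imp_antecedents_def)
  moreover have "card (imp_antecedents (subformulas A) \<union> imp_antecedents (subformulas B)) \<le>
      card (imp_antecedents (subformulas A)) + card (imp_antecedents (subformulas B))"
    by (rule card_Un_le)
  ultimately show ?case using Imp by (simp add: card_insert_if)
qed (auto simp: imp_antecedents_def)

lemma symbols_subformula: "A \<in> subformulas F \<Longrightarrow> symbols A \<le> symbols F"
  by (induction F) auto

lemma subformula_closedD:
  assumes "subformula_closed S"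
  shows "A \<^bold>\<and> B \<in> S \<Longrightarrow> A \<in> S \<and> B \<in> S"
    and "A \<^bold>\<or> B \<in> S \<Longrightarrow> A \<in> S \<and> B \<in> S"
    and "A \<^bold>\<longrightarrow> B \<in> S \<Longrightarrow> A \<in> S \<and> B \<in> S"
  using assms subformulas_self by (fastforce simp: subformula_closed_def)+

text \<open>The subformula property: premises are built from formulas of the conclusion and their
  immediate subformulas. Hence a set \<open>S\<close> chosen at the root serves every node.\<close>

lemma GBU_rule_premise_forms:
  assumes "GBU_rule ps \<sigma>" "p \<in> set ps" "subformula_closed S" "seq_forms \<sigma> \<subseteq> S"
  shows "seq_forms p \<subseteq> S"
  using assms by cases (auto dest: subformula_closedD)

lemma sum_symbols_insert_le:
  "finite \<Psi> \<Longrightarrow> (\<Sum>F\<in>insert A \<Psi>. symbols F) \<le> symbols A + (\<Sum>F\<in>\<Psi>. symbols F)"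
  by (simp add: sum.insert_if)

text \<open>Where a left rule consumes its principal formula, a clause of \<open>Cl\<close> rebuilds
  it: a conjunction from both parts, a disjunction from either part, an implication from its
  consequent. The other antecedents only stay or grow.\<close>

lemma GBU_rule_premise_antecedent:
  assumes "GBU_rule ps \<sigma>" "p \<in> set ps"
  shows "antecedent \<sigma> \<subseteq> Cl (antecedent p)"
  using assms by cases (auto intro: Cl_base Cl_and[OF Cl_base Cl_base] Cl_or1[OF Cl_base]
      Cl_or2[OF Cl_base] Cl_imp[OF Cl_base])

lemma GBU_rule_potential_less:
  assumes rule: "GBU_rule ps \<sigma>" and p: "p \<in> set ps"
    and fin: "finite (antecedent \<sigma>)" "finite (imp_antecedents S)"
    and forms: "seq_forms \<sigma> \<subseteq> S" and bound: "\<And>F. F \<in> S \<Longrightarrow> symbols F \<le> N"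
  shows "potential S N p < potential S N \<sigma>"
proof -
  let ?k = "\<lambda>\<Psi>. card (imp_antecedents S - Cl \<Psi>)"
  \<comment> \<open>Folding the product into an opaque \<open>K\<close> leaves only linear
    inequalities in the cases below.\<close>
  define K where "K \<Psi> = N * ?k \<Psi>" for \<Psi>
  note [simp] = K_def[symmetric]
  have "Cl (antecedent \<sigma>) \<subseteq> Cl (antecedent p)"
    by (rule Cl_least[OF GBU_rule_premise_antecedent[OF rule p]])
  then have "?k (antecedent p) \<le> ?k (antecedent \<sigma>)"
    using fin by (intro card_mono) auto
  then have k: "K (antecedent p) \<le> K (antecedent \<sigma>)"
    by (simp add: K_def del: K_def[symmetric])
  from rule p fin(1) forms k show ?thesis
  proof cases
    \<comment> \<open>By the side condition of the left rules the principal formula is not in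
      \<Psi>, so the sum over the conclusion counts its connective, which the premises lose.\<close>
    case (L_and A B \<Psi> C)
    with p fin(1) k show ?thesis
      using sum_symbols_insert_le[of "insert B \<Psi>" A] sum_symbols_insert_le[of \<Psi> B] by simp
  next
    case (L_or A B \<Psi> C)
    with p fin(1) k show ?thesis
      using sum_symbols_insert_le[of \<Psi> A] sum_symbols_insert_le[of \<Psi> B] by auto
  next
    case (L_imp A B \<Psi> C)
    \<comment> \<open>The left premise keeps the antecedent, gives up the bonus \<open>N\<close> and
      gets the succedent \<open>A\<close>, whose size is strictly below this bound.\<close>
    then have "symbols (A \<^bold>\<longrightarrow> B) \<le> N"
      using forms by (intro bound) auto
    with L_imp p fin(1) k show ?thesis
      using sum_symbols_insert_le[of \<Psi> B] by auto
  next
    case (R_imp_notin_reg A \<Psi> B)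
    with p fin(1) k show ?thesis
      using sum_symbols_insert_le[of \<Psi> A] by auto
  next
    case (R_imp_notin_irr A \<Psi> B)
    \<comment> \<open>The premise gains the bonus \<open>N\<close>. It is paid for by
      \<open>A\<close>, which newly enters the closure, so that \<open>K\<close> drops by at least
      \<open>N\<close>; the strict decrease comes from the lost arrow.\<close>
    have "A \<in> imp_antecedents S"
      using R_imp_notin_irr forms by (auto simp: imp_antecedents_def)
    moreover have "A \<in> Cl (insert A \<Psi>)"
      by (simp add: Cl_base)
    moreover have "Cl \<Psi> \<subseteq> Cl (insert A \<Psi>)"
      by (rule Cl_least) (auto intro: Cl_base)
    ultimately have "?k (insert A \<Psi>) < ?k \<Psi>"
      using R_imp_notin_irr fin by (intro psubset_card_mono) auto
    then have "K (insert A \<Psi>) + N \<le> K \<Psi>"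
      unfolding K_def by (metis Suc_leI mult_Suc_right mult_le_mono2 add.commute)
    with R_imp_notin_irr p fin(1) show ?thesis
      using sum_symbols_insert_le[of \<Psi> A] by auto
  qed auto
qed

lemma GBU_tree_root_sequent: "GBU_tree G T \<Longrightarrow> GBU_sequent G (root T)"
  by (auto elim: GBU_tree.cases)

lemma GBU_sequent_finite: "GBU_sequent G \<sigma> \<Longrightarrow> finite (antecedent \<sigma>)"
  by (cases \<sigma>) (auto intro: finite_subset[OF _ finite_Sl])

text \<open>Every edge costs at least one unit of potential, so no branch is longer than the value
  at the root.\<close>

lemma height_le_potential:
  assumes "GBU_tree G T" "seq_forms (root T) \<subseteq> S"
    and S: "subformula_closed S" "finite (imp_antecedents S)" "\<And>F. F \<in> S \<Longrightarrow> symbols F \<le> N"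
  shows "height T \<le> potential S N (root T)"
  using assms(1,2)
proof (induction rule: GBU_tree.induct)
  case (Leaf \<sigma>)
  then show ?case by simp
next
  case (Step \<sigma> ts)
  have "height t < potential S N \<sigma>" if t: "t \<in> set ts" for t
  proof -
    have p: "root t \<in> set (map root ts)"
      using t by simp
    have forms: "seq_forms \<sigma> \<subseteq> S"
      using Step.prems by simp
    have "height t \<le> potential S N (root t)"
      using Step.IH[OF t] GBU_rule_premise_forms[OF Step.hyps(3) p S(1) forms] by simp
    also have "\<dots> < potential S N \<sigma>"
      using GBU_rule_potential_less[OF Step.hyps(3) p GBU_sequent_finite[OF Step.hyps(1)]
          S(2) forms S(3)] by simp
    finally show ?thesis .
  qed
  then have "Max (height ` set ts) < potential S N \<sigma>"
    using Step.hyps(2) by (subst Max_less_iff) auto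
  then show ?case using Step.hyps(2) by (simp del: Max_less_iff)
qed

lemma height_le_seq_size:
  assumes "GBU_tree G T"
  shows "height T \<le> 3 * (seq_size (root T))\<^sup>2"
proof -
  define \<tau> where "\<tau> = root T"
  define n where "n = seq_size \<tau>"
  define S where "S = (\<Union>F\<in>seq_forms \<tau>. subformulas F)"
  have fin: "finite (antecedent \<tau>)"
    using assms by (auto simp: \<tau>_def intro: GBU_sequent_finite GBU_tree_root_sequent)
  have n: "n = (\<Sum>F\<in>antecedent \<tau>. symbols F) + symbols (succedent \<tau>)"
    by (cases \<tau>) (auto simp: n_def)
  have "symbols F \<le> n" if "F \<in> seq_forms \<tau>" for F
    using that member_le_sum[of F "antecedent \<tau>" symbols] fin by (auto simp: n)
  then have bound: "symbols F \<le> n" if "F \<in> S" for F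
    using that symbols_subformula unfolding S_def by (meson UN_E le_trans)
  have closed: "subformula_closed S"
    using subformulas_trans by (fastforce simp: subformula_closed_def S_def)
  have finS: "finite (imp_antecedents S)"
    unfolding S_def imp_antecedents_UN using fin imp_antecedents_subformulas by auto
  have "card (imp_antecedents S) \<le> (\<Sum>F\<in>seq_forms \<tau>. card (imp_antecedents (subformulas F)))"
    unfolding S_def imp_antecedents_UN using fin by (intro card_UN_le) simp
  also have "\<dots> \<le> (\<Sum>F\<in>seq_forms \<tau>. symbols F)"
    using imp_antecedents_subformulas by (intro sum_mono) blast
  \<comment> \<open>Only an inequality, since the succedent may also occur in the
    antecedent.\<close>
  also have "\<dots> \<le> n"
    using sum_symbols_insert_le[OF fin, of "succedent \<tau>"] by (simp add: n)
  finally have "card (imp_antecedents S) \<le> n" .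
  moreover have "card (imp_antecedents S - Cl (antecedent \<tau>)) \<le> card (imp_antecedents S)"
    using finS by (intro card_mono) auto
  ultimately have "n * card (imp_antecedents S - Cl (antecedent \<tau>)) \<le> n * n"
    by (intro mult_le_mono2) simp
  \<comment> \<open>One \<open>n\<close> is the size of the sequent, the other the bonus of a
    regular root.\<close>
  moreover have
      "potential S n \<tau> \<le> n * card (imp_antecedents S - Cl (antecedent \<tau>)) + n + n"
    using n by (cases \<tau>) auto
  ultimately have "potential S n \<tau> \<le> n * n + n + n"
    by linarith
  \<comment> \<open>For natural numbers \<open>n\<close> is at most its square, also when
    \<open>n\<close> is 0, so no additive constant remains.\<close>
  also have "\<dots> \<le> 3 * n\<^sup>2"
    using le_square[of n] unfolding power2_eq_square by linarith
  finally have "potential S n \<tau> \<le> 3 * n\<^sup>2" .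
  moreover have "seq_forms \<tau> \<subseteq> S"
    using subformulas_self by (auto simp: S_def)
  then have "height T \<le> potential S n \<tau>"
    using height_le_potential[OF assms _ closed finS bound] by (simp add: \<tau>_def)
  ultimately show ?thesis by (simp add: n_def \<tau>_def)
qed

theorem theorem5p4:
  "\<exists>c :: nat. \<forall>G T \<tau>. GBU_tree G T \<and> root T = \<tau> \<longrightarrow> height T \<le> c * (seq_size \<tau>)\<^sup>2"
  using height_le_seq_size by blast

end
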